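(* Let $p$ be a prime number and let $S=\{1,p,p^2,p^3,\ldots\}$ be the set of powers of $p$. Then for every positive integer $i$ the generalised factorial ${i!}_S$ satisfies $${i!}_S=i!\cdot f_{i-1}\big(X(\mathbb{F}_p^i)\big).$$
   Context: $X(\mathbb{F}_p^n)$ is the simplicial complex whose vertices are the nonzero vectors of $\mathbb{F}_p^n$ and whose simplices are the linearly independent (unimodular) subsets of $\mathbb{F}_p^n$; $f_i(K)$ denotes the number of $i$-dimensional simplices (those with $i+1$ vertices) of a simplicial complex $K$. Let $S$ be an infinite subset of $\mathbb{Z}$ and $\ell$ a prime. An $\ell$-ordering on $S$ is a sequence $(a_k)_{k\ge 0}$ of elements of $S$ such that $a_0\in S$ is arbitrary and, for every $k\geq 1$, $a_k\in S$ is chosen to minimise the highest power of $\ell$ dividing $(a_k-a_{k-1})\cdots(a_k-a_1)(a_k-a_0)$. Let $\nu_k(S,\ell)$ be the highest power of $\ell$ (as an integer $\ell^e$) dividing $(a_k-a_{k-1})\cdots(a_k-a_0)$; it is independent of the choice of $\ell$-ordering (Bhargava). Bhargava's generalised factorial is ${k!}_S=\prod_{\ell}\nu_k(S,\ell)$, the product over all primes $\ell$. *)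

theory Defs
  imports
    "HOL-Number_Theory.Number_Theory"
    "HOL-Library.Extended_Nat"
    "HOL-Library.Groups_Big_Fun"
    "Jordan_Normal_Form.Missing_VectorSpace"
begin

definition vec_Fp :: "nat \<Rightarrow> nat \<Rightarrow> (int, nat \<Rightarrow> int) module" where
  "vec_Fp p n = ring.func_space (residue_ring (int p)) {..<n}"

(* A simplicial complex is given by its set of simplices. The empty set is independent and so
   belongs to X_Fp; it has dimension -1 and is not counted by any f_num K i. *)

definition X_Fp :: "nat \<Rightarrow> nat \<Rightarrow> (nat \<Rightarrow> int) set set" where
  "X_Fp p n =
     {\<sigma>. \<sigma> \<subseteq> carrier (vec_Fp p n) - {\<zero>\<^bsub>vec_Fp p n\<^esub>} \<and>
          \<not> LinearCombinations.module.lin_dep (residue_ring (int p)) (vec_Fp p n) \<sigma>}"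

definition f_num :: "'a set set \<Rightarrow> nat \<Rightarrow> nat" where
  "f_num K i = card {\<sigma> \<in> K. card \<sigma> = i + 1}"

(* The library sets multiplicity l 0 = 0, whereas every power of l divides 0. With the library
   value, an earlier element could always be repeated as a minimising choice. *)

definition l_val :: "nat \<Rightarrow> int \<Rightarrow> enat" where
  "l_val l x = (if x = 0 then \<infinity> else enat (multiplicity (int l) x))"

definition l_ordering :: "int set \<Rightarrow> nat \<Rightarrow> (nat \<Rightarrow> int) \<Rightarrow> bool" where
  "l_ordering S l a \<longleftrightarrow>
     a 0 \<in> S \<and>
     (\<forall>k\<ge>1. a k \<in> S \<and>
        (\<forall>s\<in>S. l_val l (\<Prod>j<k. a k - a j) \<le> l_val l (\<Prod>j<k. s - a j)))"

(* By Bhargava's theorem the value does not depend on the l-ordering, so an arbitrary one is used.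
   For infinite S and prime l an l-ordering exists and all these products are nonzero, so
   multiplicity is genuine: see ex_l_ordering and l_ordering_prod_nonzero. *)

definition nu :: "int set \<Rightarrow> nat \<Rightarrow> nat \<Rightarrow> nat" where
  "nu S l k =
     (let a = (SOME a. l_ordering S l a) in l ^ multiplicity (int l) (\<Prod>j<k. a k - a j))"

(* Prod_any yields 1 when infinitely many factors differ from 1; by finite_nu_neq_1 this does not
   happen for infinite S. *)

definition gen_fact :: "int set \<Rightarrow> nat \<Rightarrow> nat" where
  "gen_fact S k = Prod_any (\<lambda>l. if prime l then nu S l k else 1)"

lemma ex_l_ordering:
  assumes "S \<noteq> {}"
  shows "\<exists>a. l_ordering S l a"
proof -
  define P where "P = (\<lambda>(f :: nat \<Rightarrow> int) (k :: nat) r. r \<in> S \<and>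
    (\<forall>s\<in>S. l_val l (\<Prod>j<k. r - f j) \<le> l_val l (\<Prod>j<k. s - f j)))"
  have "\<exists>a. \<forall>k. P a k (a k)"
  proof (rule dependent_wellorder_choice[where P = P])
    fix r and f g :: "nat \<Rightarrow> int" and k :: nat
    assume "\<And>z. z < k \<Longrightarrow> f z = g z"
    then have "(\<Prod>j<k. s - f j) = (\<Prod>j<k. s - g j)" for s
      by (intro prod.cong) auto
    then show "P f k r = P g k r" by (simp add: P_def)
  next
    fix k :: nat and f :: "nat \<Rightarrow> int"
    obtain s0 where "s0 \<in> S" using assms by blast
    show "\<exists>r. P f k r"
      unfolding P_def
    proof -
      let ?v = "\<lambda>s. l_val l (\<Prod>j<k. s - f j)"
      define m where "m = (LEAST n. n \<in> ?v ` S)"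
      have "m \<in> ?v ` S" unfolding m_def using \<open>s0 \<in> S\<close> by (intro LeastI[of "\<lambda>n. n \<in> ?v ` S"]) auto
      then obtain r where "r \<in> S" "m = ?v r" by blast
      moreover have "m \<le> ?v s" if "s \<in> S" for s
        unfolding m_def by (rule Least_le) (use that in auto)
      ultimately show "\<exists>r. r \<in> S \<and> (\<forall>s\<in>S. ?v r \<le> ?v s)" by auto
    qed
  qed
  then obtain a where "\<forall>k. P a k (a k)" by blast
  then have "l_ordering S l a" by (auto simp: P_def l_ordering_def)
  then show ?thesis by blast
qed

lemma l_ordering_prod_nonzero:
  assumes "infinite S" "l_ordering S l a"
  shows "(\<Prod>j<k. a k - a j) \<noteq> 0"
proof (cases k)
  case (Suc k')
  obtain s where s: "s \<in> S" "s \<notin> a ` {..<k}"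
    using assms(1) by (metis finite_imageI finite_lessThan finite_subset subsetI)
  then have "(\<Prod>j<k. s - a j) \<noteq> 0" by auto
  moreover have "l_val l (\<Prod>j<k. a k - a j) \<le> l_val l (\<Prod>j<k. s - a j)"
    using assms(2) s(1) Suc unfolding l_ordering_def by (metis le_add1 plus_1_eq_Suc)
  ultimately show ?thesis by (auto simp: l_val_def split: if_splits)
qed auto

lemma finite_nu_neq_1:
  assumes "infinite S"
  shows "finite {l. prime l \<and> nu S l k \<noteq> 1}"
proof -
  obtain T where T: "T \<subseteq> S" "finite T" "card T = Suc k"
    using infinite_arbitrarily_large[OF assms] by blast
  define B where "B = (\<Union>x\<in>T. \<Union>y\<in>T - {x}. {l :: nat. int l dvd x - y})"
  have "finite {l :: nat. int l dvd d}" if "d \<noteq> 0" for d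
  proof -
    have "{l :: nat. int l dvd d} \<subseteq> {..nat \<bar>d\<bar>}"
      using that by (auto dest!: dvd_imp_le_int simp: le_nat_iff)
    then show ?thesis by (rule finite_subset) simp
  qed
  then have "finite B" unfolding B_def using T(2) by auto
  moreover have "{l. prime l \<and> nu S l k \<noteq> 1} \<subseteq> B"
  proof (rule subsetI, rule ccontr)
    fix l assume "l \<in> {l. prime l \<and> nu S l k \<noteq> 1}" and nB: "l \<notin> B"
    then have l: "prime l" "nu S l k \<noteq> 1" by auto
    define a where "a = (SOME a. l_ordering S l a)"
    have a: "l_ordering S l a"
      unfolding a_def using ex_l_ordering[of S l] assms 
      by (metis (no_types, lifting) someI_ex finite.emptyI)
    have "inj_on (\<lambda>x. x mod int l) T"
      using nB by (auto simp: B_def inj_on_def mod_eq_dvd_iff)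
    then have "card ((\<lambda>x. x mod int l) ` T) = Suc k" using T(3) by (simp add: card_image)
    moreover have "card ((\<lambda>j. a j mod int l) ` {..<k}) \<le> k"
      using card_image_le[of "{..<k}"] by force
    ultimately have "\<not> (\<lambda>x. x mod int l) ` T \<subseteq> (\<lambda>j. a j mod int l) ` {..<k}"
      by (metis card_mono finite_imageI finite_lessThan le_trans not_less_eq_eq)
    then obtain s where s: "s \<in> T" "\<forall>j<k. s mod int l \<noteq> a j mod int l" by blast
    have pl: "prime (int l)" using l(1) by simp
    have nd: "\<not> int l dvd (\<Prod>j<k. s - a j)"
      using s(2) by (auto simp: prime_dvd_prod_iff[OF _ pl] mod_eq_dvd_iff)
    have "(\<Prod>j<k. s - a j) \<noteq> 0" using nd by (metis dvd_0_right)
    with nd have "l_val l (\<Prod>j<k. s - a j) = 0"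
      by (simp del: prod_zero_iff add: l_val_def not_dvd_imp_multiplicity_0 zero_enat_def)
    moreover have "k = 0 \<or> l_val l (\<Prod>j<k. a k - a j) \<le> l_val l (\<Prod>j<k. s - a j)"
      using a s(1) T(1) by (cases k) (auto simp: l_ordering_def simp del: prod.lessThan_Suc)
    ultimately have "multiplicity (int l) (\<Prod>j<k. a k - a j) = 0"
      by (auto simp: l_val_def zero_enat_def split: if_splits)
    then show False using l(2) by (simp add: nu_def Let_def flip: a_def)
  qed
  ultimately show ?thesis by (rule finite_subset[rotated])
qed

end

theory Submission
  imports Defs
begin

text \<open>
  Both sides equal \<open>(p^i - 1) * (p^i - p) * \<dots> * (p^i - p^(i-1))\<close>.

  For the left-hand side, the sequence \<open>1, p, p^2, \<dots>\<close> is an \<open>l\<close>-ordering of \<open>S\<close> for every prime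
  \<open>l\<close> at once. The reason is that the product \<open>\<Prod>j<k. p^k - p^j\<close> divides
  \<open>\<Prod>j<k. p^m - p^j\<close> for every \<open>m\<close>: the quotient is a Gaussian binomial coefficient
  (lemma \<open>q_falling_product_dvd\<close>). The function \<open>nu\<close> refers to an unspecified \<open>l\<close>-ordering, so
  Bhargava's theorem that the valuations are the same for all \<open>l\<close>-orderings is also needed
  (theorem \<open>l_ordering_multiplicity_unique\<close>). Then the factors of \<open>gen_fact S i\<close> are the
  prime powers exactly dividing the single integer \<open>\<Prod>j<i. p^i - p^j\<close>.

  For the right-hand side, \<open>i! * f_(i-1)\<close> counts the ordered linearly independent families of
  length \<open>i\<close> in an \<open>i\<close>-dimensional space over the field with \<open>p\<close> elements. The vector chosen
  after \<open>m\<close> independent ones has to avoid their span, which has \<open>p^m\<close> elements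
  (theorem \<open>card_indpt_sets\<close>).
\<close>

section \<open>Independence of the valuations from the ordering\<close>

text \<open>
  The Newton polynomials \<open>\<Prod>i<j. x - a i\<close> are monic, so a monic polynomial can be expanded in
  them without division: the coefficients stay in the ring, and the top one is \<open>1\<close>. Only
  completely split polynomials are expanded here, which makes it possible to work with
  functions and to multiply in one linear factor at a time.
\<close>
lemma newton_expansion_exists:
  fixes a b :: "nat \<Rightarrow> 'a :: comm_ring_1"
  shows "\<exists>d. d k = 1 \<and> (\<forall>x. (\<Prod>j<k. x - b j) = (\<Sum>j\<le>k. d j * (\<Prod>i<j. x - a i)))"
proof (induction k)
  case 0
  show ?case by (intro exI[of _ "\<lambda>_. 1"]) simp
next
  case (Suc k)
  then obtain d where d: "d k = 1" "\<And>x. (\<Prod>j<k. x - b j) = (\<Sum>j\<le>k. d j * (\<Prod>i<j. x - a i))"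
    by blast
  define e where "e j = (if j = 0 then 0 else d (j - 1)) + (if j \<le> k then d j * (a j - b k) else 0)" for j
  have "(\<Prod>j<Suc k. x - b j) = (\<Sum>j\<le>Suc k. e j * (\<Prod>i<j. x - a i))" for x
  proof -
    define N where "N j = (\<Prod>i<j. x - a i)" for j
    have N_Suc: "N (Suc j) = N j * (x - a j)" for j by (simp add: N_def)
    have "(\<Prod>j<Suc k. x - b j) = (\<Sum>j\<le>k. d j * N j * (x - b k))"
      by (simp add: d(2) N_def sum_distrib_right)
    \<comment> \<open>Multiplying by \<open>x - b k = (x - a j) + (a j - b k)\<close> either raises the index of
      the Newton polynomial by one or keeps it.\<close>
    also have "\<dots> = (\<Sum>j\<le>k. d j * N (Suc j)) + (\<Sum>j\<le>k. d j * (a j - b k) * N j)"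
      by (simp add: N_Suc algebra_simps flip: sum.distrib)
    also have "(\<Sum>j\<le>k. d j * N (Suc j)) = (\<Sum>j\<le>Suc k. (if j = 0 then 0 else d (j - 1)) * N j)"
      by (subst sum.atMost_Suc_shift) simp
    also have "(\<Sum>j\<le>k. d j * (a j - b k) * N j) =
        (\<Sum>j\<le>Suc k. (if j \<le> k then d j * (a j - b k) else 0) * N j)"
      by simp
    also have "(\<Sum>j\<le>Suc k. (if j = 0 then 0 else d (j - 1)) * N j) + \<dots> = (\<Sum>j\<le>Suc k. e j * N j)"
      unfolding e_def distrib_right sum.distrib ..
    finally show ?thesis by (simp only: N_def)
  qed
  moreover have "e (Suc k) = 1" using d(1) by (simp add: e_def)
  ultimately show ?case by blast
qed

lemma l_ordering_multiplicity_dvd: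
  assumes S: "infinite S" and l: "prime l" and a: "l_ordering S l a" and s: "s \<in> S"
  shows "int l ^ multiplicity (int l) (\<Prod>j<k. a k - a j) dvd (\<Prod>j<k. s - a j)"
proof (cases "k = 0 \<or> (\<Prod>j<k. s - a j) = 0")
  case False
  then have "l_val l (\<Prod>j<k. a k - a j) \<le> l_val l (\<Prod>j<k. s - a j)"
    using a s unfolding l_ordering_def by (cases k) (auto simp del: prod.lessThan_Suc)
  with False have "multiplicity (int l) (\<Prod>j<k. a k - a j) \<le> multiplicity (int l) (\<Prod>j<k. s - a j)"
    using l_ordering_prod_nonzero[OF S a, of k] by (auto simp: l_val_def simp del: prod_zero_iff)
  then show ?thesis by (rule multiplicity_dvd')
qed (auto simp del: prod_zero_iff)

lemma l_ordering_range: "l_ordering S l a \<Longrightarrow> a k \<in> S"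
  by (cases k) (auto simp: l_ordering_def)

text \<open>
  Expand \<open>\<Prod>j<k. x - b j\<close> in the Newton polynomials of \<open>a\<close>. Evaluating at \<open>a 0, a 1, \<dots>\<close>
  in turn isolates one new summand at a time, which is therefore divisible by \<open>l^e\<close> at \<open>a j\<close>.
  By minimality \<open>a j\<close> is the worst point for the \<open>j\<close>-th Newton polynomial, so the summand is
  divisible by \<open>l^e\<close> on all of \<open>S\<close> and can be subtracted in the later steps. The last
  summand is the claim, because its coefficient is \<open>1\<close>.
\<close>
lemma prime_power_dvd_l_ordering_prod:
  assumes S: "infinite S" and l: "prime l" and a: "l_ordering S l a"
    and dvd: "\<And>s. s \<in> S \<Longrightarrow> int l ^ e dvd (\<Prod>j<k. s - b j)"
  shows "int l ^ e dvd (\<Prod>j<k. a k - a j)"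
proof -
  define N where "N j x = (\<Prod>i<j. x - a i)" for j x
  obtain d where d: "d k = 1" "\<And>x. (\<Prod>j<k. x - b j) = (\<Sum>j\<le>k. d j * N j x)"
    using newton_expansion_exists[of k b a] unfolding N_def by blast
  have pl: "prime (int l)" using l by simp
  have dvd_on_S: "int l ^ e dvd d j * N j s" if j: "int l ^ e dvd d j * N j (a j)" and s: "s \<in> S" for j s
  proof -
    define m where "m = multiplicity (int l) (N j (a j))"
    have nz: "N j (a j) \<noteq> 0" unfolding N_def by (rule l_ordering_prod_nonzero[OF S a])
    obtain u where u: "N j (a j) = int l ^ m * u" "\<not> int l dvd u"
      unfolding m_def using nz pl by (meson multiplicity_decompose' not_prime_unit)
    have "coprime (int l ^ e) u"
      using u(2) pl by (simp add: prime_imp_coprime)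
    with j u(1) have "int l ^ e dvd d j * int l ^ m"
      by (metis coprime_dvd_mult_left_iff mult.assoc)
    also have "\<dots> dvd d j * N j s"
      unfolding m_def N_def by (intro mult_dvd_mono dvd_refl l_ordering_multiplicity_dvd[OF S l a s])
    finally show ?thesis .
  qed
  have "j \<le> k \<Longrightarrow> int l ^ e dvd d j * N j (a j)" for j
  proof (induction j rule: less_induct)
    case (less j)
    \<comment> \<open>At \<open>a j\<close> all Newton polynomials of index above \<open>j\<close> vanish.\<close>
    have "(\<Prod>i<k. a j - b i) = (\<Sum>i\<le>k. d i * N i (a j))" by (rule d(2))
    also have "\<dots> = (\<Sum>i\<le>j. d i * N i (a j))"
    proof (rule sum.mono_neutral_right)
      have "N i (a j) = 0" if "j < i" for i
        unfolding N_def using that by (intro prod_zero) auto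
      then show "\<forall>i\<in>{..k} - {..j}. d i * N i (a j) = 0" by simp
    qed (use less.prems in auto)
    also have "\<dots> = (\<Sum>i<j. d i * N i (a j)) + d j * N j (a j)"
      unfolding lessThan_Suc_atMost[symmetric] sum.lessThan_Suc ..
    finally have "d j * N j (a j) = (\<Prod>i<k. a j - b i) - (\<Sum>i<j. d i * N i (a j))" by simp
    moreover have "int l ^ e dvd (\<Sum>i<j. d i * N i (a j))"
    proof (rule dvd_sum)
      show "int l ^ e dvd d i * N i (a j)" if "i \<in> {..<j}" for i
        by (rule dvd_on_S[OF less.IH l_ordering_range[OF a]]) (use less.prems that in auto)
    qed
    ultimately show ?case
      using dvd[OF l_ordering_range[OF a]] by simp
  qed
  from this[of k] show ?thesis by (simp add: d(1) N_def)
qed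

text \<open>
  Bhargava's independence theorem: the previous lemma, with the product of \<open>b\<close> in the role of
  the polynomial, bounds the valuation of \<open>b\<close> by that of \<open>a\<close>, and the roles can be exchanged.
\<close>
theorem l_ordering_multiplicity_unique:
  assumes "infinite S" "prime l" "l_ordering S l a" "l_ordering S l b"
  shows "multiplicity (int l) (\<Prod>j<k. a k - a j) = multiplicity (int l) (\<Prod>j<k. b k - b j)"
proof -
  have "multiplicity (int l) (\<Prod>j<k. b k - b j) \<le> multiplicity (int l) (\<Prod>j<k. a k - a j)"
    if a: "l_ordering S l a" and b: "l_ordering S l b" for a b
  proof (rule multiplicity_geI)
    show "\<not> is_unit (int l)" using prime_gt_1_nat[OF assms(2)] by simp
    show "(\<Prod>j<k. a k - a j) \<noteq> 0" by (rule l_ordering_prod_nonzero[OF assms(1) a])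
    show "int l ^ multiplicity (int l) (\<Prod>j<k. b k - b j) dvd (\<Prod>j<k. a k - a j)"
    proof (rule prime_power_dvd_l_ordering_prod[OF assms(1,2) a])
      show "int l ^ multiplicity (int l) (\<Prod>j<k. b k - b j) dvd (\<Prod>j<k. s - b j)"
        if "s \<in> S" for s
        by (rule l_ordering_multiplicity_dvd[OF assms(1,2) b that])
    qed
  qed
  from this[OF assms(3,4)] this[OF assms(4,3)] show ?thesis by simp
qed

corollary nu_eq_l_ordering:
  assumes "infinite S" "prime l" "l_ordering S l a"
  shows "nu S l k = l ^ multiplicity (int l) (\<Prod>j<k. a k - a j)"
proof -
  have "l_ordering S l (SOME a. l_ordering S l a)"
    by (rule someI[of "l_ordering S l", OF assms(3)])
  from l_ordering_multiplicity_unique[OF assms this, of k] show ?thesis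
    unfolding nu_def Let_def by (simp only:)
qed

lemma multiplicity_int_of_nat:
  assumes "prime l"
  shows "multiplicity (int l) (int x) = multiplicity l x"
proof (cases "x = 0")
  case False
  have "multiplicity l x < Suc (multiplicity l x)" "\<not> is_unit l"
    using prime_gt_1_nat[OF assms] by simp_all
  then have "\<not> l ^ Suc (multiplicity l x) dvd x"
    using False multiplicity_geI by (metis not_less)
  moreover have "l ^ multiplicity l x dvd x" by (rule multiplicity_dvd)
  ultimately show ?thesis
    by (intro multiplicity_eqI; unfold of_nat_power[symmetric] int_dvd_int_iff)
qed simp

lemma prod_prime_power_multiplicity:
  fixes x :: nat
  assumes "x > 0"
  shows "Prod_any (\<lambda>l. if prime l then l ^ multiplicity l x else 1) = x"
proof -
  have "Prod_any (\<lambda>l. if prime l then l ^ multiplicity l x else 1) =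
      (\<Prod>l\<in>prime_factors x. if prime l then l ^ multiplicity l x else 1)"
  proof (rule Prod_any.expand_superset)
    show "{l. (if prime l then l ^ multiplicity l x else 1) \<noteq> 1} \<subseteq> prime_factors x"
    proof
      fix l assume "l \<in> {l. (if prime l then l ^ multiplicity l x else 1) \<noteq> 1}"
      then have "prime l" "multiplicity l x \<noteq> 0" by (auto split: if_splits intro!: gr0I)
      then show "l \<in> prime_factors x"
        using assms not_dvd_imp_multiplicity_0[of l x] by (auto simp: in_prime_factors_iff)
    qed
  qed simp
  also have "\<dots> = (\<Prod>l\<in>prime_factors x. l ^ multiplicity l x)"
    by (intro prod.cong) auto
  also have "\<dots> = x" using assms by (simp add: prime_factorization_nat[symmetric])
  finally show ?thesis .
qed

text \<open>
  If one sequence serves all primes, the factors \<open>nu S l k\<close> are the local parts of one and the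
  same integer, and unique factorisation reassembles it up to sign.
\<close>
theorem gen_fact_eq_simultaneous_ordering:
  assumes S: "infinite S" and a: "\<And>l. prime l \<Longrightarrow> l_ordering S l a"
  shows "gen_fact S k = nat \<bar>\<Prod>j<k. a k - a j\<bar>"
proof -
  define x where "x = nat \<bar>\<Prod>j<k. a k - a j\<bar>"
  have "(\<Prod>j<k. a k - a j) \<noteq> 0"
    using l_ordering_prod_nonzero[OF S a[OF two_is_prime_nat]] .
  then have x: "x > 0" unfolding x_def by linarith
  have "multiplicity (int l) (\<Prod>j<k. a k - a j) = multiplicity l x" if "prime l" for l
  proof -
    have "int x = \<bar>\<Prod>j<k. a k - a j\<bar>" unfolding x_def by simp
    then have "multiplicity (int l) (\<Prod>j<k. a k - a j) = multiplicity (int l) (int x)"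
      by (metis multiplicity_normalize_right normalize_int_def)
    also have "\<dots> = multiplicity l x" by (rule multiplicity_int_of_nat[OF that])
    finally show ?thesis .
  qed
  then have "nu S l k = l ^ multiplicity l x" if "prime l" for l
    using nu_eq_l_ordering[OF S that a[OF that], of k] that by (simp only:)
  then have "gen_fact S k = Prod_any (\<lambda>l. if prime l then l ^ multiplicity l x else 1)"
    unfolding gen_fact_def by (simp cong: if_cong)
  also have "\<dots> = x" by (rule prod_prime_power_multiplicity[OF x])
  finally show ?thesis by (simp only: x_def)
qed

section \<open>The powers of a number\<close>

text \<open>
  The quotient is the Gaussian binomial coefficient \<open>[m choose k]\<close> in \<open>q\<close>, and
  the induction is its Pascal rule
  \<open>[m + 1 choose k + 1] = [m choose k] + q^(k+1) * [m choose k + 1]\<close> with denominators cleared.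
  For \<open>m < k\<close> the right-hand product contains the factor \<open>q^m - q^m\<close>, so no case distinction on
  the order of \<open>m\<close> and \<open>k\<close> is necessary.
\<close>
lemma q_falling_product_dvd:
  fixes q :: "'a :: comm_ring_1"
  shows "(\<Prod>j<k. q ^ k - q ^ j) dvd (\<Prod>j<k. q ^ m - q ^ j)"
proof (induction m arbitrary: k)
  case 0
  show ?case by (cases k) (simp_all add: prod.lessThan_Suc_shift del: prod.lessThan_Suc)
next
  case (Suc m)
  show ?case
  proof (cases k)
    case 0
    then show ?thesis by simp
  next
    case [simp]: (Suc k')
    define G where "G m k = (\<Prod>j<k. q ^ m - q ^ j)" for m k
    have shift: "G (Suc n) (Suc k') = q ^ k' * (q ^ Suc n - 1) * G n k'" for n
    proof -
      have "(\<Prod>j<k'. q ^ Suc n - q ^ Suc j) = (\<Prod>j<k'. q * (q ^ n - q ^ j))"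
        by (intro prod.cong) (simp_all add: right_diff_distrib)
      also have "\<dots> = q ^ k' * G n k'" by (simp add: prod.distrib G_def)
      finally have "G (Suc n) (Suc k') = (q ^ Suc n - 1) * (q ^ k' * G n k')"
        unfolding G_def prod.lessThan_Suc_shift by simp
      then show ?thesis by (simp only: mult_ac)
    qed
    \<comment> \<open>Pascal's rule, from \<open>q^k' * (q^(m+1) - 1) = q^k' * (q^(k'+1) - 1) + q^(k'+1) * (q^m - q^k')\<close>.\<close>
    have "G (Suc m) (Suc k') = q ^ k' * (q ^ Suc k' - 1) * G m k' + q ^ Suc k' * (G m k' * (q ^ m - q ^ k'))"
      unfolding shift by (simp add: algebra_simps)
    also have "G m k' * (q ^ m - q ^ k') = G m (Suc k')" by (simp add: G_def)
    finally have "G (Suc m) (Suc k') = q ^ k' * (q ^ Suc k' - 1) * G m k' + q ^ Suc k' * G m (Suc k')" .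
    moreover have "G (Suc k') (Suc k') dvd q ^ k' * (q ^ Suc k' - 1) * G m k'"
      unfolding shift by (intro mult_dvd_mono dvd_refl) (use Suc.IH[of k'] in \<open>simp add: G_def\<close>)
    moreover have "G (Suc k') (Suc k') dvd q ^ Suc k' * G m (Suc k')"
      using Suc.IH[of "Suc k'"] by (intro dvd_mult) (simp only: G_def)
    ultimately have "G (Suc k') (Suc k') dvd G (Suc m) (Suc k')" by (simp only: dvd_add)
    then show ?thesis by (simp only: G_def Suc)
  qed
qed

lemma l_val_mono_dvd: "l_val l x \<le> l_val l y" if "prime l" "x dvd y"
  using that dvd_imp_multiplicity_le[of x y "int l"]
  by (auto simp: l_val_def)

lemma l_ordering_powers:
  assumes "prime l"
  shows "l_ordering (range (\<lambda>k. q ^ k)) l (\<lambda>k. q ^ k)"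
  using assms unfolding l_ordering_def
  by (auto simp del: power_0 intro!: l_val_mono_dvd q_falling_product_dvd)

lemma infinite_range_power: "infinite (range (\<lambda>k::nat. q ^ k))" if "q > 1" for q :: int
  using that by (intro range_inj_infinite injI) simp

theorem gen_fact_powers:
  fixes q :: int
  assumes "q > 1"
  shows "int (gen_fact (range (\<lambda>k. q ^ k)) k) = (\<Prod>j<k. q ^ k - q ^ j)"
proof -
  have "(\<Prod>j<k. q ^ k - q ^ j) \<ge> 0"
    using assms by (intro prod_nonneg) (auto intro!: power_increasing)
  then show ?thesis
    by (subst gen_fact_eq_simultaneous_ordering[of _ "\<lambda>k. q ^ k"])
      (simp_all add: infinite_range_power[OF assms] l_ordering_powers)
qed

section \<open>Counting linearly independent sets\<close>

context vectorspace
begin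

text \<open>Independence makes the coefficients of a linear combination unique.\<close>
lemma card_span_lin_indpt:
  assumes A: "finite A" "A \<subseteq> carrier V" "lin_indpt A"
  shows "card (span A) = card (carrier K) ^ card A"
proof -
  have "inj_on (\<lambda>a. lincomb a A) (A \<rightarrow>\<^sub>E carrier K)"
  proof (rule inj_onI)
    fix a b assume ab: "a \<in> A \<rightarrow>\<^sub>E carrier K" "b \<in> A \<rightarrow>\<^sub>E carrier K" "lincomb a A = lincomb b A"
    then have a: "a \<in> A \<rightarrow> carrier K" and b: "b \<in> A \<rightarrow> carrier K" by auto
    have "lincomb (\<lambda>v. a v \<ominus>\<^bsub>K\<^esub> b v) A = lincomb a A \<ominus>\<^bsub>V\<^esub> lincomb b A"
      by (rule lincomb_diff[OF A(1,2) a b])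
    also have "\<dots> = \<zero>\<^bsub>V\<^esub>"
      using ab(3) b A(2) by simp
    finally have "(\<lambda>v. a v \<ominus>\<^bsub>K\<^esub> b v) \<in> A \<rightarrow> {\<zero>\<^bsub>K\<^esub>}"
      using a b by (intro not_lindepD[OF A(3,1) order_refl]) auto
    then have "a v = b v" if "v \<in> A" for v
      using R.r_right_minus_eq[OF funcset_mem[OF a that] funcset_mem[OF b that]] that by auto
    then show "a = b" using ab(1,2) by (rule PiE_ext[rotated 2])
  qed
  moreover have "(\<lambda>a. lincomb a A) ` (A \<rightarrow>\<^sub>E carrier K) = span A"
  proof -
    have "lincomb a A \<in> (\<lambda>a. lincomb a A) ` (A \<rightarrow>\<^sub>E carrier K)" if a: "a \<in> A \<rightarrow> carrier K" for a
    proof (rule image_eqI)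
      show "lincomb a A = lincomb (restrict a A) A"
        using a A(2) by (intro lincomb_cong) auto
    qed (use a in auto)
    then show ?thesis unfolding finite_span[OF A(1,2)] by auto
  qed
  ultimately have "card (span A) = card (A \<rightarrow>\<^sub>E carrier K)"
    using card_image by metis
  then show ?thesis by (simp add: card_PiE A(1))
qed

definition indpt_sets :: "nat \<Rightarrow> 'c set set" where
  "indpt_sets j = {\<sigma>. \<sigma> \<subseteq> carrier V \<and> lin_indpt \<sigma> \<and> finite \<sigma> \<and> card \<sigma> = j}"

text \<open>
  Count the pairs of an independent set with \<open>j + 1\<close> elements and one distinguished element
  of it. Removing the distinguished element leaves an independent set with \<open>j\<close> elements and a
  vector outside its span, and every such pair arises in this way.
\<close>
lemma card_indpt_sets_Suc:
  assumes fin: "finite (carrier V)"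
  shows "Suc j * card (indpt_sets (Suc j)) =
    card (indpt_sets j) * (card (carrier V) - card (carrier K) ^ j)"
proof -
  have fin_indpt: "finite (indpt_sets j)" for j
    by (rule finite_subset[of _ "Pow (carrier V)"]) (auto simp: indpt_sets_def fin)
  have card_compl: "card (carrier V - span \<sigma>) = card (carrier V) - card (carrier K) ^ j"
    if "\<sigma> \<in> indpt_sets j" for \<sigma>
  proof -
    have "span \<sigma> \<subseteq> carrier V" using that by (auto simp: indpt_sets_def dest: span_is_subset2)
    then show ?thesis
      using that card_span_lin_indpt[of \<sigma>] fin
      by (simp add: card_Diff_subset indpt_sets_def finite_subset)
  qed
  have "bij_betw (\<lambda>(\<sigma>, v). (insert v \<sigma>, v))
      (SIGMA \<sigma>:indpt_sets j. carrier V - span \<sigma>) (SIGMA \<tau>:indpt_sets (Suc j). \<tau>)"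
  proof (rule bij_betw_byWitness[where f' = "\<lambda>(\<tau>, v). (\<tau> - {v}, v)"])
    have new: "v \<notin> \<sigma>" if "\<sigma> \<in> indpt_sets j" "v \<notin> span \<sigma>" for v \<sigma> j
      using that in_own_span[of \<sigma>] by (auto simp: indpt_sets_def)
    then show "\<forall>x\<in>SIGMA \<sigma>:indpt_sets j. carrier V - span \<sigma>.
        (\<lambda>(\<tau>, v). (\<tau> - {v}, v)) ((\<lambda>(\<sigma>, v). (insert v \<sigma>, v)) x) = x"
      by fastforce
    show "\<forall>x\<in>SIGMA \<tau>:indpt_sets (Suc j). \<tau>.
        (\<lambda>(\<sigma>, v). (insert v \<sigma>, v)) ((\<lambda>(\<tau>, v). (\<tau> - {v}, v)) x) = x"
      by auto
    have "insert v \<sigma> \<in> indpt_sets (Suc j)"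
      if "\<sigma> \<in> indpt_sets j" "v \<in> carrier V" "v \<notin> span \<sigma>" for \<sigma> v
      using that new[OF that(1,3)] lin_dep_iff_in_span[of \<sigma> v] by (auto simp: indpt_sets_def)
    then show "(\<lambda>(\<sigma>, v). (insert v \<sigma>, v)) ` (SIGMA \<sigma>:indpt_sets j. carrier V - span \<sigma>)
        \<subseteq> (SIGMA \<tau>:indpt_sets (Suc j). \<tau>)"
      by auto
    have "\<tau> - {v} \<in> indpt_sets j \<and> v \<in> carrier V - span (\<tau> - {v})"
      if "\<tau> \<in> indpt_sets (Suc j)" "v \<in> \<tau>" for \<tau> v
      using that subset_li_is_li[of \<tau> "\<tau> - {v}"] lindep_span[of \<tau>] by (auto simp: indpt_sets_def)
    then show "(\<lambda>(\<tau>, v). (\<tau> - {v}, v)) ` (SIGMA \<tau>:indpt_sets (Suc j). \<tau>)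
        \<subseteq> (SIGMA \<sigma>:indpt_sets j. carrier V - span \<sigma>)"
      by auto
  qed
  then have "card (SIGMA \<sigma>:indpt_sets j. carrier V - span \<sigma>) = card (SIGMA \<tau>:indpt_sets (Suc j). \<tau>)"
    by (rule bij_betw_same_card)
  moreover have "card (SIGMA \<sigma>:indpt_sets j. carrier V - span \<sigma>) =
      card (indpt_sets j) * (card (carrier V) - card (carrier K) ^ j)"
    using fin by (simp add: card_SigmaI fin_indpt card_compl)
  moreover have "card (SIGMA \<tau>:indpt_sets (Suc j). \<tau>) = card (indpt_sets (Suc j)) * Suc j"
    by (subst card_SigmaI) (auto simp: fin_indpt, auto simp: indpt_sets_def)
  ultimately show ?thesis by (simp add: mult.commute)
qed

theorem card_indpt_sets:
  assumes "finite (carrier V)"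
  shows "fact j * card (indpt_sets j) = (\<Prod>m<j. card (carrier V) - card (carrier K) ^ m)"
proof (induction j)
  case 0
  have "indpt_sets 0 = {{}}" by (auto simp: indpt_sets_def lin_dep_def)
  then show ?case by simp
next
  case (Suc j)
  have "fact (Suc j) * card (indpt_sets (Suc j)) = fact j * (Suc j * card (indpt_sets (Suc j)))"
    by (simp add: algebra_simps)
  also have "\<dots> = fact j * card (indpt_sets j) * (card (carrier V) - card (carrier K) ^ j)"
    by (simp only: card_indpt_sets_Suc[OF assms] mult.assoc)
  finally show ?case by (simp add: Suc.IH)
qed

end

section \<open>Simplices of the complex of unimodular sets\<close>

text \<open>
  A simplex of dimension \<open>d\<close> is an independent set with \<open>d + 1\<close> elements; it is automatically
  finite, since infinite sets have cardinality \<open>0\<close>, and consists of nonzero vectors.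
\<close>
lemma fact_f_num_X_Fp:
  assumes "prime p"
  shows "fact (Suc d) * f_num (X_Fp p n) d = (\<Prod>m<Suc d. p ^ n - p ^ m)"
proof -
  interpret F: residues_prime p "residue_ring (int p)"
    using assms by unfold_locales auto
  interpret V: vectorspace "residue_ring (int p)" "vec_Fp p n"
    unfolding vec_Fp_def vectorspace_def
    by (intro conjI F.func_space_is_module F.is_field)
  have card_K: "card (carrier (residue_ring (int p))) = p"
    by (simp add: residue_ring_def)
  have carrier_V: "carrier (vec_Fp p n) = {..<n} \<rightarrow>\<^sub>E carrier (residue_ring (int p))"
    by (simp add: vec_Fp_def F.func_space_def)
  have fin: "finite (carrier (vec_Fp p n))"
    unfolding carrier_V by (intro finite_PiE) (simp_all add: residue_ring_def)
  have card_V: "card (carrier (vec_Fp p n)) = p ^ n"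
    by (simp add: carrier_V card_PiE card_K)
  have "carrier (residue_ring (int p)) \<noteq> {\<zero>\<^bsub>residue_ring (int p)\<^esub>}"
    using F.one_not_zero F.one_closed by blast
  then have "{\<sigma> \<in> X_Fp p n. card \<sigma> = d + 1} = V.indpt_sets (Suc d)"
    by (auto simp: X_Fp_def V.indpt_sets_def dest: V.zero_nin_lin_indpt intro: card_ge_0_finite)
  then have "f_num (X_Fp p n) d = card (V.indpt_sets (Suc d))"
    by (simp only: f_num_def)
  then show ?thesis
    using V.card_indpt_sets[OF fin, of "Suc d"] by (simp only: card_V card_K)
qed

theorem proposition6p3:
  fixes p i :: nat
  assumes "prime p" and "i \<ge> 1"
  shows "gen_fact (range (\<lambda>k::nat. int p ^ k)) i = fact i * f_num (X_Fp p i) (i - 1)"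
proof -
  have "int (gen_fact (range (\<lambda>k. int p ^ k)) i) = (\<Prod>j<i. int p ^ i - int p ^ j)"
    using prime_gt_1_nat[OF assms(1)] by (intro gen_fact_powers) simp
  also have "\<dots> = (\<Prod>j<i. int (p ^ i - p ^ j))"
  proof (rule prod.cong)
    fix j assume "j \<in> {..<i}"
    then have "p ^ j \<le> p ^ i"
      using prime_gt_0_nat[OF assms(1)] by (intro power_increasing) auto
    then show "int p ^ i - int p ^ j = int (p ^ i - p ^ j)"
      by (simp add: of_nat_diff)
  qed simp
  also have "\<dots> = int (\<Prod>j<i. p ^ i - p ^ j)" by simp
  also have "(\<Prod>j<i. p ^ i - p ^ j) = fact i * f_num (X_Fp p i) (i - 1)"
    using fact_f_num_X_Fp[OF assms(1), of "i - 1" i] assms(2) by simp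
  finally show ?thesis by (simp only: of_nat_eq_iff)
qed

end
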